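(* Assume GCH. Let $\kappa\le\lambda$ be cardinals with $\omega_2\le\kappa$. Then every hypergraph $\mathcal E\subseteq[\lambda]^{\kappa}$ possessing property $C(2,\omega)$ has a maximizing well-ordering.
   Context: A hypergraph is identified with a family $\mathcal E$ of non-empty sets (its edges); its vertex set is $\bigcup\mathcal E$. $[\lambda]^{\kappa}$ is the set of subsets of $\lambda$ of cardinality exactly $\kappa$. A hypergraph $\mathcal E$ possesses property $C(k,\rho)$ iff $|\bigcap\mathcal E'|<\rho$ for every set $\mathcal E'\subseteq\mathcal E$ of exactly $k$ distinct edges. A maximizing well-ordering of $\mathcal E$ is a well-ordering $\preceq$ of the vertex set $\bigcup\mathcal E$ such that every edge $E\in\mathcal E$ has a $\preceq$-maximal element. *)

theory Defs
  imports Main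
begin

unbundle cardinal_syntax

(* A formula cannot quantify over types, so GCH is stated for the cardinals that live on a
   given type: every cardinal of cardinality at most that of 'a is represented by a cardinal
   order on a subset of 'a. The full GCH implies GCH TYPE('a) for every 'a. *)
definition GCH :: "'a itself \<Rightarrow> bool" where
  "GCH _ \<longleftrightarrow> (\<forall>\<mu> :: 'a rel. Cinfinite \<mu> \<longrightarrow> ctwo ^c \<mu> =o cardSuc \<mu>)"

(* A family of sets stands for the hypergraph with these edges and with vertex set
   \<Union>\<E>; there are no isolated vertices. *)
definition hypergraph :: "'a set set \<Rightarrow> bool" where
  "hypergraph \<E> \<longleftrightarrow> {} \<notin> \<E>"

definition subsets_of_card :: "'a rel \<Rightarrow> 'b rel \<Rightarrow> 'a set set" where
  "subsets_of_card \<Lambda> \<kappa> = {A. A \<subseteq> Field \<Lambda> \<and> |A| =o \<kappa>}"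

definition property_C :: "'k rel \<Rightarrow> 'r rel \<Rightarrow> 'a set set \<Rightarrow> bool" where
  "property_C k \<rho> \<E> \<longleftrightarrow> (\<forall>\<E>'. \<E>' \<subseteq> \<E> \<and> |\<E>'| =o k \<longrightarrow> |\<Inter>\<E>'| <o \<rho>)"

(* r is read as a reflexive order: (x, y) \<in> r means that x precedes or equals y. *)
definition maximizing_well_order :: "'a set set \<Rightarrow> 'a rel \<Rightarrow> bool" where
  "maximizing_well_order \<E> r \<longleftrightarrow>
     well_order_on (\<Union>\<E>) r \<and>
     (\<forall>E\<in>\<E>. \<exists>x\<in>E. \<forall>y\<in>E. (x, y) \<in> r \<longrightarrow> y = x)"

end

theory Submission
  imports Defs "HOL-Library.Countable_Set_Type"
begin

text \<open>It suffices to well-order the edges so that no edge is covered by the earlier ones. This is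
  easy when there are at most \<open>\<kappa>\<close> edges. In general, induct on the size of the vertex set
  \<open>A\<close>, and exhaust \<open>A\<close> by an increasing chain of smaller sets \<open>C x\<close>, each containing
  every edge that it meets uncountably. Under GCH such closures do not increase cardinality. An edge
  first swallowed by \<open>C x\<close> meets each earlier \<open>C y\<close> countably, hence their union in at
  most \<open>\<omega>\<^sub>1 < \<kappa>\<close> points, so the induction hypothesis applies to what remains of
  it.\<close>

section \<open>Cardinal bounds from small initial segments and chains\<close>

lemma finite_card_of_less_infinite: "finite A \<Longrightarrow> infinite B \<Longrightarrow> |A| <o |B|"
  by (meson finite_iff_ordLess_natLeq infinite_iff_natLeq_ordLeq ordLess_ordLeq_trans)

text \<open>If S had more than k elements, the order that W induces on S would be longer than k, and
  a proper initial segment of it would be isomorphic to k and hence have k elements.\<close>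

lemma card_of_le_if_underS_less:
  fixes W :: "'a rel" and k :: "'b rel"
  assumes W: "Well_order W" and S: "S \<subseteq> Field W" and k: "Card_order k"
    and less: "\<And>a. a \<in> S \<Longrightarrow> |S \<inter> underS W a| <o k"
  shows "|S| \<le>o k"
proof (rule ccontr)
  assume "\<not> |S| \<le>o k"
  then have "k <o |S|"
    using k by (meson card_of_Well_order card_order_on_well_order_on not_ordLeq_iff_ordLess)
  moreover have wS: "well_order_on S (Restr W S)"
    using W S by (rule well_order_on_Restr)
  ultimately have "k <o Restr W S"
    using card_of_least ordLess_ordLeq_trans by blast
  then obtain a where a: "a \<in> S" and iso: "k =o Restr (Restr W S) (underS (Restr W S) a)"
    using ordLess_iff_ordIso_Restr[of "Restr W S" k] wS k well_order_on_Well_order[OF wS]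
    by (auto simp: card_order_on_well_order_on)
  have "|Field k| \<le>o |Field (Restr (Restr W S) (underS (Restr W S) a))|"
    using iso by (simp add: ordIso_iff_ordLeq card_of_mono2)
  also have "|Field (Restr (Restr W S) (underS (Restr W S) a))| \<le>o |S \<inter> underS W a|"
    using a by (intro card_of_mono1) (auto simp: Field_def underS_def)
  also have "|S \<inter> underS W a| <o k"
    using less[OF a] .
  finally have "|Field k| <o k" .
  then show False
    using card_of_Field_ordIso[OF k] not_ordLess_ordIso by blast
qed

text \<open>Map each point to the first index whose set contains it. By monotonicity, the used
  indices below a used index t are attained at points of \<open>C t\<close>, so they are countably
  many. Hence at most \<open>\<omega>\<^sub>1\<close> indices are used, and their sets cover the
  union.\<close>

lemma card_of_UN_chain_countable:
  assumes W: "Well_order W" and I: "I \<subseteq> Field W"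
    and mono: "\<And>i j. i \<in> I \<Longrightarrow> j \<in> I \<Longrightarrow> (i, j) \<in> W \<Longrightarrow> C i \<subseteq> C j"
    and count: "\<And>i. i \<in> I \<Longrightarrow> countable (C i)"
  shows "|\<Union>i\<in>I. C i| \<le>o cardSuc natLeq"
proof -
  define \<rho> where "\<rho> x = wo_rel.minim W {i \<in> I. x \<in> C i}" for x
  have W': "wo_rel W"
    using W by (simp add: wo_rel_def)
  have \<rho>: "\<rho> x \<in> I" "x \<in> C (\<rho> x)" if "x \<in> (\<Union>i\<in>I. C i)" for x
    using wo_rel.minim_in[OF W', of "{i \<in> I. x \<in> C i}"] that I
    by (auto simp: \<rho>_def)
  define T where "T = \<rho> ` (\<Union>i\<in>I. C i)"
  have T: "T \<subseteq> I"
    using \<rho> by (auto simp: T_def)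
  have "|T \<inter> underS W t| <o cardSuc natLeq" if t: "t \<in> T" for t
  proof -
    have "T \<inter> underS W t \<subseteq> \<rho> ` C t"
    proof
      fix s assume "s \<in> T \<inter> underS W t"
      then obtain x where "x \<in> (\<Union>i\<in>I. C i)" "s = \<rho> x" "(s, t) \<in> W"
        by (auto simp: T_def underS_def)
      then show "s \<in> \<rho> ` C t"
        using \<rho>[of x] mono[of s t] t T by auto
    qed
    then have "countable (T \<inter> underS W t)"
      using count t T by (meson countable_image countable_subset subsetD)
    then show ?thesis
      by (simp add: countable_card_le_natLeq cardSuc_ordLeq_ordLess natLeq_Card_order card_of_Card_order)
  qed
  then have "|T| \<le>o cardSuc natLeq"
    using card_of_le_if_underS_less[OF W, of T] T I
    by (meson cardSuc_Card_order natLeq_Card_order subset_trans)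
  moreover have "\<forall>t\<in>T. |C t| \<le>o cardSuc natLeq"
    using T count cardSuc_ordLeq[OF natLeq_Card_order]
    by (meson countable_card_le_natLeq ordLeq_transitive subsetD)
  ultimately have "|\<Union>t\<in>T. C t| \<le>o cardSuc natLeq"
    by (intro UNION_Cinfinite_bound Cinfinite_cardSuc natLeq_Cinfinite)
  moreover have "(\<Union>i\<in>I. C i) = (\<Union>t\<in>T. C t)"
    using \<rho> T unfolding T_def by blast
  ultimately show ?thesis
    by simp
qed

section \<open>From orders of edges to orders of vertices\<close>

text \<open>In a total relation a failure of transitivity closes a cycle, which well-foundedness
  forbids.\<close>

lemma wf_total_imp_well_order_on:
  assumes wf: "wf S" and tot: "total_on V S"
  shows "well_order_on V (Restr S V \<union> Id_on V)" (is "well_order_on V ?r")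
proof -
  have "trans ?r"
  proof (rule transI)
    fix x y z assume xy: "(x, y) \<in> ?r" and yz: "(y, z) \<in> ?r"
    show "(x, z) \<in> ?r"
    proof (rule ccontr)
      assume n: "(x, z) \<notin> ?r"
      with xy yz have "(x, y) \<in> S" "(y, z) \<in> S" "x \<in> V" "z \<in> V" "x \<noteq> z"
        by (auto dest: wf_not_sym[OF wf])
      with n have "(z, x) \<in> S"
        using tot by (auto simp: total_on_def)
      with \<open>(x, y) \<in> S\<close> \<open>(y, z) \<in> S\<close> have "(x, x) \<in> S\<^sup>+"
        by (meson trancl.simps)
      then show False
        using wf_acyclic[OF wf] by (simp add: acyclic_def)
    qed
  qed
  moreover have "antisym ?r"
    using wf by (auto intro!: antisymI dest: wf_not_sym)
  moreover have "wf (?r - Id)"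
    using wf by (rule wf_subset) auto
  moreover have "total_on V ?r"
    using tot by (auto simp: total_on_def)
  moreover have "refl_on V ?r" "?r \<subseteq> V \<times> V"
    by (auto simp: refl_on_def)
  ultimately show ?thesis
    by (auto simp: well_order_on_def linear_order_on_def partial_order_on_def preorder_on_def)
qed

text \<open>\<open>(F, E) \<in> R\<close> is read as F coming strictly before E. Well-foundedness
  and totality make R a strict well-order on \<H>.\<close>

definition noncovering_order :: "'a set set \<Rightarrow> 'a set rel \<Rightarrow> bool" where
  "noncovering_order \<H> R \<longleftrightarrow>
     wf R \<and> total_on \<H> R \<and> (\<forall>E\<in>\<H>. \<not> E \<subseteq> \<Union>{F\<in>\<H>. (F, E) \<in> R})"

text \<open>Vertices are ordered by the first edge containing them, and inside the fresh part of an
  edge a chosen vertex is put last.\<close>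

lemma noncovering_order_imp_maximizing:
  fixes \<H> :: "'a set set"
  assumes "noncovering_order \<H> R"
  shows "\<exists>r. maximizing_well_order \<H> r"
proof -
  have wf: "wf R" and tot: "total_on \<H> R"
    and "\<forall>E\<in>\<H>. \<exists>x. x \<in> E \<and> (\<forall>F\<in>\<H>. (F, E) \<in> R \<longrightarrow> x \<notin> F)"
    using assms unfolding noncovering_order_def by blast+
  then obtain x where x: "\<And>E. E \<in> \<H> \<Longrightarrow> x E \<in> E"
    and fresh: "\<And>E F. E \<in> \<H> \<Longrightarrow> F \<in> \<H> \<Longrightarrow> (F, E) \<in> R \<Longrightarrow> x E \<notin> F"
    by metis
  have "\<exists>E. E \<in> \<H> \<and> v \<in> E \<and> (\<forall>F\<in>\<H>. v \<in> F \<longrightarrow> (F, E) \<notin> R)" if v: "v \<in> \<Union>\<H>" for v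
  proof -
    from v have "{E \<in> \<H>. v \<in> E} \<noteq> {}"
      by blast
    then obtain E where "E \<in> {E \<in> \<H>. v \<in> E}" "\<And>F. (F, E) \<in> R \<Longrightarrow> F \<notin> {E \<in> \<H>. v \<in> E}"
      by (rule wfE_min'[OF wf]) blast
    then show ?thesis
      by blast
  qed
  then obtain e where e: "\<And>v. v \<in> \<Union>\<H> \<Longrightarrow> e v \<in> \<H>" "\<And>v. v \<in> \<Union>\<H> \<Longrightarrow> v \<in> e v"
    and first: "\<And>v F. v \<in> \<Union>\<H> \<Longrightarrow> F \<in> \<H> \<Longrightarrow> v \<in> F \<Longrightarrow> (F, e v) \<notin> R"
    by metis
  have e_eq: "F = e v \<or> (e v, F) \<in> R" if "F \<in> \<H>" "v \<in> F" for v F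
    using that e[of v] first[of v F] tot by (auto simp: total_on_def)
  obtain W :: "'a rel" where W: "well_order W"
    using well_order_on by blast
  \<comment> \<open>First edges are compared first; among vertices with the same first edge,
    \<open>False\<close> before \<open>True\<close> puts the chosen vertex last; W breaks the
    remaining ties.\<close>
  define S where "S = inv_image (R <*lex*> {(False, True)} <*lex*> (W - Id)) (\<lambda>v. (e v, v = x (e v), v))"
  have "wf S"
    using wf W unfolding S_def
    by (intro wf_inv_image wf_lex_prod) (auto simp: well_order_on_def)
  moreover have "total_on (\<Union>\<H>) S"
  proof (rule total_onI)
    fix u v assume "u \<in> \<Union>\<H>" "v \<in> \<Union>\<H>" "u \<noteq> v"
    then have "e u = e v \<or> (e u, e v) \<in> R \<or> (e v, e u) \<in> R"
      using e tot by (metis total_on_def)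
    moreover have "(u, v) \<in> W \<or> (v, u) \<in> W"
      using W \<open>u \<noteq> v\<close> by (auto simp: order_on_defs total_on_def)
    ultimately show "(u, v) \<in> S \<or> (v, u) \<in> S"
      using \<open>u \<noteq> v\<close> by (auto simp: S_def)
  qed
  ultimately have wo: "well_order_on (\<Union>\<H>) (Restr S (\<Union>\<H>) \<union> Id_on (\<Union>\<H>))" (is "well_order_on _ ?r")
    by (rule wf_total_imp_well_order_on)
  have "\<exists>z\<in>E. \<forall>y\<in>E. (z, y) \<in> ?r \<longrightarrow> y = z" if E: "E \<in> \<H>" for E
  proof (intro bexI ballI impI)
    show "x E \<in> E"
      using x[OF E] .
    \<comment> \<open>No edge before E contains \<open>x E\<close>, so E is its first edge. Any
      other vertex of E has first edge E or an earlier one, so it precedes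
      \<open>x E\<close>.\<close>
    have exE: "e (x E) = E"
      using e_eq[OF E x[OF E]] fresh[OF E, of "e (x E)"] e[of "x E"] x[OF E] E by auto
    fix y assume y: "y \<in> E" and xy: "(x E, y) \<in> ?r"
    show "y = x E"
    proof (rule ccontr)
      assume "y \<noteq> x E"
      then have "(y, x E) \<in> S"
        using e_eq[OF E y] exE by (auto simp: S_def)
      moreover have "(x E, y) \<in> S"
        using xy \<open>y \<noteq> x E\<close> by auto
      ultimately show False
        using \<open>wf S\<close> wf_not_sym by fast
    qed
  qed
  then show ?thesis
    using wo unfolding maximizing_well_order_def by blast
qed

section \<open>Families with at most k edges\<close>

text \<open>Finitely many finite traces have a finite union; for infinite P the union has at most
  \<open>|P|\<close> points. Singular k are thus covered too.\<close>

lemma finite_Int_imp_card_of_Int_UN_less: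
  assumes k: "Cinfinite k" and P: "|P| <o k" and fin: "\<And>F. F \<in> P \<Longrightarrow> finite (E \<inter> F)"
  shows "|E \<inter> \<Union>P| <o k"
proof -
  have "|\<Union>F\<in>P. E \<inter> F| <o k"
  proof (cases "finite P")
    case True
    then have "finite (\<Union>F\<in>P. E \<inter> F)"
      using fin by (rule finite_UN_I)
    then show ?thesis
      using k by (meson finite_iff_ordLess_natLeq natLeq_ordLeq_cinfinite ordLess_ordLeq_trans)
  next
    case False
    then have "|\<Union>F\<in>P. E \<inter> F| \<le>o |P|"
      using fin
      by (intro card_of_UNION_ordLeq_infinite ballI)
        (simp_all add: card_of_refl ordIso_imp_ordLeq ordLess_imp_ordLeq finite_card_of_less_infinite)
    then show ?thesis
      using P by (rule ordLeq_ordLess_trans)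
  qed
  then show ?thesis
    by (simp only: Int_Union)
qed

text \<open>A cardinal order of \<H> gives each edge fewer than k predecessors, and each of them
  takes only finitely many of its k points.\<close>

lemma noncovering_order_if_card_le:
  assumes k: "Cinfinite k" and le: "|\<H>| \<le>o k" and card: "\<And>E. E \<in> \<H> \<Longrightarrow> |E| =o k"
    and fin: "pairwise (\<lambda>E F. finite (E \<inter> F)) \<H>"
  shows "\<exists>R. noncovering_order \<H> R"
proof -
  let ?W = "|\<H>|"
  have wo: "well_order_on \<H> ?W"
    by (rule card_of_well_order_on)
  have "\<not> E \<subseteq> \<Union>{F \<in> \<H>. (F, E) \<in> ?W - Id}" if E: "E \<in> \<H>" for E
  proof
    let ?P = "{F \<in> \<H>. (F, E) \<in> ?W - Id}"
    assume "E \<subseteq> \<Union>?P"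
    moreover have "|?P| <o k"
    proof (rule ordLeq_ordLess_trans)
      show "|?P| \<le>o |underS ?W E|"
        by (rule card_of_mono1) (auto simp: underS_def)
      show "|underS ?W E| <o k"
        using card_of_underS[OF card_of_Card_order[of \<H>], of E] E le
        by (simp add: Field_card_of ordLess_ordLeq_trans)
    qed
    then have "|E \<inter> \<Union>?P| <o k"
      using k fin E by (intro finite_Int_imp_card_of_Int_UN_less) (auto simp: pairwise_def)
    ultimately show False
      using card[OF E] not_ordLess_ordIso by (auto simp: Int_absorb2)
  qed
  moreover have "total_on \<H> (?W - Id)"
    using wo by (auto simp: order_on_defs total_on_def)
  ultimately show ?thesis
    using wo unfolding noncovering_order_def well_order_on_def by blast
qed

section \<open>Counting edges by their traces under GCH\<close>

lemma GCH_Pow_le: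
  fixes A B :: "'a set"
  assumes "GCH TYPE('a)" and A: "infinite A" and less: "|B| <o |A|"
  shows "|Pow B| \<le>o |A|"
proof (cases "finite B")
  case True
  then show ?thesis
    using A by (simp add: ordLess_imp_ordLeq finite_card_of_less_infinite)
next
  case False
  then have "Cinfinite |B|"
    by (simp add: cinfinite_def Field_card_of card_of_card_order_on)
  then have "ctwo ^c |B| =o cardSuc |B|"
    using assms(1) by (simp add: GCH_def)
  moreover have "|Pow B| =o ctwo ^c |B|"
    unfolding ctwo_def cexp_def Field_card_of by (rule card_of_Pow_Func)
  moreover have "cardSuc |B| \<le>o |A|"
    using less by (simp add: cardSuc_least card_of_Card_order)
  ultimately show ?thesis
    by (meson ordIso_ordLeq_trans ordIso_transitive)
qed

text \<open>An edge meeting A in an uncountable set already has an infinite trace on a proper initial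
  segment of A, and that trace determines the edge. This avoids any cofinality distinction.\<close>

lemma card_of_uncountable_traces:
  fixes A :: "'a set"
  assumes gch: "GCH TYPE('a)" and fin: "pairwise (\<lambda>E F. finite (E \<inter> F)) \<H>"
    and unc: "\<And>E. E \<in> \<H> \<Longrightarrow> uncountable (E \<inter> A)"
  shows "|\<H>| \<le>o |A|"
proof (cases "infinite A")
  case False
  then have "\<H> = {}"
    using unc by (auto simp: countable_finite)
  then show ?thesis
    by (simp add: card_of_empty)
next
  case inf: True
  let ?W = "|A|"
  have "\<exists>a\<in>A. infinite (E \<inter> underS ?W a)" if E: "E \<in> \<H>" for E
  proof (rule ccontr)
    assume "\<not> ?thesis"
    \<comment> \<open>If every proper initial segment met E finitely, the trace would have order
      type at most \<omega>.\<close>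
    then have "|E \<inter> A| \<le>o natLeq"
      by (intro card_of_le_if_underS_less[of "|A|"] card_of_Well_order natLeq_Card_order)
        (auto simp: Field_card_of finite_iff_ordLess_natLeq[symmetric] intro: finite_subset[rotated])
    then show False
      using unc[OF E] by (simp add: countable_card_le_natLeq)
  qed
  then obtain a where a: "\<And>E. E \<in> \<H> \<Longrightarrow> a E \<in> A"
    and infa: "\<And>E. E \<in> \<H> \<Longrightarrow> infinite (E \<inter> underS ?W (a E))"
    by metis
  let ?f = "\<lambda>E. (a E, E \<inter> underS ?W (a E))"
  have "inj_on ?f \<H>"
  proof (rule inj_onI, rule ccontr)
    fix E F assume EF: "E \<in> \<H>" "F \<in> \<H>" "?f E = ?f F" "E \<noteq> F"
    then have "E \<inter> underS ?W (a E) \<subseteq> E \<inter> F"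
      by blast
    moreover have "finite (E \<inter> F)"
      using fin EF by (auto simp: pairwise_def)
    ultimately show False
      using infa EF finite_subset by blast
  qed
  then have "|\<H>| \<le>o |SIGMA x : A. Pow (underS ?W x)|"
    using a by (intro card_of_ordLeq[THEN iffD1]) auto
  also have "|SIGMA x : A. Pow (underS ?W x)| \<le>o |A|"
    using inf card_of_underS[OF card_of_Card_order[of A]]
    by (intro card_of_Sigma_ordLeq_infinite ballI GCH_Pow_le gch)
      (auto simp: Field_card_of card_of_refl ordIso_imp_ordLeq)
  finally show ?thesis .
qed

section \<open>Closure under edges with uncountable trace\<close>

text \<open>The threshold is \<open>uncountable\<close> rather than \<open>infinite\<close> so that
  \<omega> rounds reach closure and trace counting bounds the number of edges added.\<close>

definition absorb :: "'a set set \<Rightarrow> 'a set \<Rightarrow> 'a set" where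
  "absorb \<H> B = B \<union> \<Union>{E \<in> \<H>. uncountable (E \<inter> B)}"

definition hull_of :: "'a set set \<Rightarrow> 'a set \<Rightarrow> 'a set" where
  "hull_of \<H> B = (\<Union>n. (absorb \<H> ^^ n) B)"

lemma absorb_mono:
  assumes "B \<subseteq> C" shows "absorb \<H> B \<subseteq> absorb \<H> C"
proof -
  have "countable (E \<inter> B)" if "countable (E \<inter> C)" for E
    using that assms by (meson Int_mono countable_subset order_refl)
  then have "{E \<in> \<H>. uncountable (E \<inter> B)} \<subseteq> {E \<in> \<H>. uncountable (E \<inter> C)}"
    by auto
  then show ?thesis
    unfolding absorb_def by (intro Un_mono Union_mono assms)
qed

lemma hull_of_mono:
  assumes "B \<subseteq> C" shows "hull_of \<H> B \<subseteq> hull_of \<H> C"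
proof -
  have "(absorb \<H> ^^ n) B \<subseteq> (absorb \<H> ^^ n) C" for n
    by (induction n) (simp_all add: assms absorb_mono)
  then show ?thesis
    unfolding hull_of_def by blast
qed

lemma subset_hull_of: "B \<subseteq> hull_of \<H> B"
  unfolding hull_of_def by (rule subsetI, rule UN_I[of 0]) auto

text \<open>A countable union of countable traces is countable, so some finite stage already meets E
  uncountably, and the next stage contains E.\<close>

lemma hull_of_absorbs:
  assumes "E \<in> \<H>" and "uncountable (E \<inter> hull_of \<H> B)"
  shows "E \<subseteq> hull_of \<H> B"
proof -
  obtain n where "uncountable (E \<inter> (absorb \<H> ^^ n) B)"
    using assms(2) countable_UN[of UNIV "\<lambda>n. E \<inter> (absorb \<H> ^^ n) B"]
    unfolding hull_of_def Int_UN_distrib by blast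
  then have "E \<subseteq> (absorb \<H> ^^ Suc n) B"
    using assms(1) by (auto simp: absorb_def)
  then show ?thesis
    unfolding hull_of_def by blast
qed

text \<open>Trace counting bounds the edges added in one round by the size of the current stage, so
  no stage outgrows B, nor does the countable union of stages.\<close>

lemma card_of_hull_of:
  fixes B :: "'a set"
  assumes gch: "GCH TYPE('a)" and fin: "pairwise (\<lambda>E F. finite (E \<inter> F)) \<H>"
    and card: "\<And>E. E \<in> \<H> \<Longrightarrow> |E| \<le>o |B|" and inf: "infinite B"
  shows "|hull_of \<H> B| \<le>o |B|"
proof -
  have "|(absorb \<H> ^^ n) B| \<le>o |B|" for n
  proof (induction n)
    case (Suc n)
    let ?C = "(absorb \<H> ^^ n) B" and ?G = "{E \<in> \<H>. uncountable (E \<inter> (absorb \<H> ^^ n) B)}"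
    have "|?G| \<le>o |?C|"
      using fin by (intro card_of_uncountable_traces[OF gch]) (auto simp: pairwise_def)
    then have "|?G| \<le>o |B|"
      using Suc ordLeq_transitive by blast
    then have "|\<Union>E\<in>?G. E| \<le>o |B|"
      using inf card by (intro card_of_UNION_ordLeq_infinite) auto
    then have "|?C \<union> \<Union>?G| \<le>o |B|"
      using Suc inf
      by (intro card_of_Un_ordLeq_infinite_Field) (simp_all add: Field_card_of card_of_card_order_on)
    then show ?case
      by (simp add: absorb_def[of \<H> ?C])
  qed (simp add: card_of_refl ordIso_imp_ordLeq)
  then show ?thesis
    unfolding hull_of_def using inf
    by (intro card_of_UNION_ordLeq_infinite) (auto simp: infinite_iff_card_of_nat)
qed

section \<open>Induction on the size of the vertex set\<close>

lemma noncovering_order_exists: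
  fixes A :: "'a set" and k :: "'b rel"
  assumes gch: "GCH TYPE('a)" and k: "Card_order k" and k2: "cardSuc (cardSuc natLeq) \<le>o k"
    and sub: "\<And>E. E \<in> \<H> \<Longrightarrow> E \<subseteq> A" and card: "\<And>E. E \<in> \<H> \<Longrightarrow> |E| =o k"
    and fin: "pairwise (\<lambda>E F. finite (E \<inter> F)) \<H>"
  shows "\<exists>R. noncovering_order \<H> R"
  using sub card fin
\<comment> \<open>The family \<H> is generalised because the induction hypothesis will be applied to
  trimmed edges inside a set of smaller cardinality.\<close>
proof (induction A arbitrary: \<H> rule: wf_induct_rule[OF wf_inv_image[OF wf_ordLess, of card_of]])
  case (1 A \<H>)
  note sub = "1.prems"(1) and card = "1.prems"(2) and fin = "1.prems"(3)
  have w1: "cardSuc natLeq <o k"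
    using k k2 by (simp add: cardSuc_ordLess_ordLeq cardSuc_Card_order natLeq_Card_order)
  have w0: "natLeq <o k"
    using cardSuc_greater[OF natLeq_Card_order] w1 by (rule ordLess_transitive)
  have ck: "Cinfinite k"
    using k w0 by (meson cinfinite_mono natLeq_cinfinite ordLess_imp_ordLeq)
  have big: "\<not> |E| \<le>o cardSuc natLeq" if "E \<in> \<H>" for E
    using card[OF that] w1 by (meson not_ordLess_ordLeq ordIso_iff_ordLeq ordLess_ordLeq_trans)
  have unc: "uncountable E" if "E \<in> \<H>" for E
    using big[OF that] cardSuc_ordLeq[OF natLeq_Card_order]
    by (meson countable_card_le_natLeq ordLeq_transitive)
  consider "\<H> = {}" | "|A| \<le>o k" | E0 where "E0 \<in> \<H>" "k <o |A|"
    using k card_of_Well_order card_order_on_well_order_on not_ordLeq_iff_ordLess by blast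
  then show ?case
  proof cases
    case 1
    then show ?thesis
      by (auto simp: noncovering_order_def intro!: exI[of _ "{}"])
  next
    case 2
    have "|\<H>| \<le>o |A|"
      using sub unc fin by (intro card_of_uncountable_traces[OF gch]) (auto simp: Int_absorb2)
    then show ?thesis
      using noncovering_order_if_card_le[OF ck _ card fin] 2 ordLeq_transitive by blast
  next
    case 3
    let ?W = "|A|"
    have W: "Well_order ?W" "Field ?W = A"
      by (simp_all add: Field_card_of card_of_well_order_on)
    have W': "wo_rel ?W"
      using W by (simp add: wo_rel_def)
    have wfW: "wf (?W - Id)"
      using W by (simp add: well_order_on_def)
    have infA: "infinite A"
      using 3 sub unc by (meson countable_finite finite_subset)
    \<comment> \<open>Including \<open>E0\<close> makes the generating set infinite and at least as
      large as every edge, as the bound on the hull requires; \<open>k <o |A|\<close> keeps it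
      smaller than A.\<close>
    define C where "C x = hull_of \<H> (underS ?W x \<union> E0)" for x
    have C_mono: "C x \<subseteq> C y" if "(x, y) \<in> ?W" for x y
      unfolding C_def using that W
      by (intro hull_of_mono) (auto simp: underS_def order_on_defs dest: transD antisymD)
    have C_less: "|C x| <o |A|" if x: "x \<in> A" for x
    proof -
      have "|underS ?W x \<union> E0| <o |A|"
        using card_of_underS[OF card_of_Card_order[of A], of x] x infA 3 card[OF 3(1)]
        by (intro card_of_Un_ordLess_infinite) (auto simp: Field_card_of intro: ordIso_ordLess_trans)
      moreover have "|C x| \<le>o |underS ?W x \<union> E0|"
        unfolding C_def
      proof (rule card_of_hull_of[OF gch fin])
        show "infinite (underS ?W x \<union> E0)"
          using unc[OF 3(1)] by (auto simp: countable_finite)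
        fix E assume "E \<in> \<H>"
        then have "|E| \<le>o |E0|"
          using card 3(1) by (meson ordIso_iff_ordLeq ordIso_symmetric ordIso_transitive)
        then show "|E| \<le>o |underS ?W x \<union> E0|"
          by (meson Un_upper2 card_of_mono1 ordLeq_transitive)
      qed
      ultimately show ?thesis
        using ordLeq_ordLess_trans by blast
    qed
    \<comment> \<open>Otherwise E meets each \<open>C x\<close> countably; as the \<open>C x\<close>
      form a chain exhausting A, E would have at most \<open>\<omega>\<^sub>1\<close>
      points.\<close>
    have "\<exists>x\<in>A. E \<subseteq> C x" if E: "E \<in> \<H>" for E
    proof (rule ccontr)
      assume "\<not> ?thesis"
      then have "countable (E \<inter> C x)" if "x \<in> A" for x
        using hull_of_absorbs[OF E] that unfolding C_def by blast
      then have "|\<Union>x\<in>A. E \<inter> C x| \<le>o cardSuc natLeq"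
        using C_mono W by (intro card_of_UN_chain_countable[of ?W]) auto
      moreover have "E \<subseteq> (\<Union>x\<in>A. E \<inter> C x)"
      proof
        fix v assume "v \<in> E"
        \<comment> \<open>The cardinal order of the infinite set A has no last element.\<close>
        then obtain x where "x \<in> A" "v \<in> underS ?W x"
          using infinite_Card_order_limit[OF card_of_Card_order[of A], of v] infA sub[OF E]
          by (auto simp: Field_card_of underS_def)
        then show "v \<in> (\<Union>x\<in>A. E \<inter> C x)"
          using \<open>v \<in> E\<close> subset_hull_of[of "underS ?W x \<union> E0" \<H>] by (auto simp: C_def)
      qed
      ultimately show False
        using big[OF E] by (meson card_of_mono1 ordLeq_transitive)
    qed
    then have A_ne: "{x \<in> A. E \<subseteq> C x} \<noteq> {}" if "E \<in> \<H>" for E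
      using that by blast
    have "\<exists>x. x \<in> A \<and> E \<subseteq> C x \<and> (\<forall>y\<in>A. (y, x) \<in> ?W - Id \<longrightarrow> \<not> E \<subseteq> C y)" if E: "E \<in> \<H>" for E
    proof -
      obtain x where "x \<in> {x \<in> A. E \<subseteq> C x}" "\<And>y. (y, x) \<in> ?W - Id \<Longrightarrow> y \<notin> {x \<in> A. E \<subseteq> C x}"
        using A_ne[OF E] by (rule wfE_min'[OF wfW]) blast
      then show ?thesis
        by blast
    qed
    then obtain \<xi> where \<xi>: "\<And>E. E \<in> \<H> \<Longrightarrow> \<xi> E \<in> A" "\<And>E. E \<in> \<H> \<Longrightarrow> E \<subseteq> C (\<xi> E)"
      and \<xi>_min: "\<And>E y. E \<in> \<H> \<Longrightarrow> (y, \<xi> E) \<in> ?W - Id \<Longrightarrow> y \<in> A \<Longrightarrow> \<not> E \<subseteq> C y"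
      by metis
    define P where "P x = (\<Union>y\<in>underS ?W x. C y)" for x
    \<comment> \<open>The part of E outside every \<open>C y\<close> earlier than the first one
      containing E; these trimmed edges are what the induction hypothesis orders.\<close>
    define t where "t E = E - P (\<xi> E)" for E
    have underS_A: "underS ?W x \<subseteq> A" for x
      using W by (auto simp: underS_def Field_def)
    have t_card: "|t E| =o k" if E: "E \<in> \<H>" for E
    proof -
      \<comment> \<open>By minimality of \<open>\<xi> E\<close>, no earlier \<open>C y\<close>
        contains E, so each meets E countably. The chain bound then shows that fewer than k points
        are removed.\<close>
      have "countable (E \<inter> C y)" if "y \<in> underS ?W (\<xi> E)" for y
        using hull_of_absorbs[OF E] \<xi>_min[OF E, of y] that underS_A
        unfolding C_def underS_def by blast
      then have "|\<Union>y\<in>underS ?W (\<xi> E). E \<inter> C y| \<le>o cardSuc natLeq"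
        using C_mono W underS_A by (intro card_of_UN_chain_countable[of ?W]) auto
      then have "|E \<inter> P (\<xi> E)| <o k"
        unfolding P_def Int_UN_distrib using w1 by (rule ordLeq_ordLess_trans)
      moreover have "t E \<union> (E \<inter> P (\<xi> E)) = E"
        by (auto simp: t_def)
      ultimately have "\<not> |t E| <o k"
        using card_of_Un_ordLess_infinite_Field[of k "t E" "E \<inter> P (\<xi> E)"] ck card[OF E] not_ordLess_ordIso
        by (auto simp: cinfinite_def)
      then have "k \<le>o |t E|"
        using k by (meson card_of_Well_order card_order_on_well_order_on not_ordLeq_iff_ordLess)
      moreover have "|t E| \<le>o k"
        using card[OF E] card_of_mono1[of "t E" E] ordLeq_ordIso_trans by (auto simp: t_def)
      ultimately show ?thesis
        by (simp add: ordIso_iff_ordLeq)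
    qed
    have t_inf: "infinite (t E)" if "E \<in> \<H>" for E
      using t_card[OF that] w0
      by (meson finite_iff_ordLess_natLeq not_ordLess_ordIso ordIso_symmetric ordLess_transitive ordLess_ordIso_trans)
    have t_sub: "t E \<subseteq> E" for E
      by (auto simp: t_def)
    \<comment> \<open>A common trimmed part would be an infinite subset of
      \<open>E \<inter> F\<close>. Injectivity lets the orders of trimmed edges be pulled back to
      edges.\<close>
    have t_inj: "t E \<noteq> t F" if "E \<in> \<H>" "F \<in> \<H>" "E \<noteq> F" for E F
    proof
      assume "t E = t F"
      then have "t E \<subseteq> E \<inter> F"
        using t_sub by blast
      then show False
        using fin that t_inf[OF that(1)] by (meson finite_subset pairwiseD)
    qed
    have "\<exists>R. noncovering_order (t ` {E \<in> \<H>. \<xi> E = x}) R" if x: "x \<in> A" for x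
    proof (rule "1.IH")
      show "(C x, A) \<in> inv_image ordLess card_of"
        using C_less[OF x] by simp
      show "pairwise (\<lambda>E F. finite (E \<inter> F)) (t ` {E \<in> \<H>. \<xi> E = x})"
        unfolding pairwise_def
      proof (intro ballI impI)
        fix X Y assume "X \<in> t ` {E \<in> \<H>. \<xi> E = x}" "Y \<in> t ` {E \<in> \<H>. \<xi> E = x}" "X \<noteq> Y"
        then obtain E F where "E \<in> \<H>" "F \<in> \<H>" "E \<noteq> F" "X = t E" "Y = t F"
          by blast
        moreover from this have "finite (E \<inter> F)"
          using fin by (simp add: pairwise_def)
        ultimately show "finite (X \<inter> Y)"
          using t_sub by (meson Int_mono finite_subset)
      qed
    qed (use t_card t_sub \<xi> in blast)+
    then obtain R where R: "\<And>x. x \<in> A \<Longrightarrow> noncovering_order (t ` {E \<in> \<H>. \<xi> E = x}) (R x)"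
      by metis
    \<comment> \<open>Edges are ordered by \<open>\<xi>\<close>, then by their trimmed parts. The
      conjunct \<open>\<xi> F \<in> A\<close> secures well-foundedness on the whole type: off \<H>
      the value of \<open>\<xi>\<close> is arbitrary, and \<open>R x\<close> is controlled only for
      x in A.\<close>
    define Q where "Q = {(E, F). \<xi> F \<in> A \<and> ((\<xi> E, \<xi> F) \<in> ?W - Id \<or> \<xi> E = \<xi> F \<and> (t E, t F) \<in> R (\<xi> F))}"
    have "wf Q"
    proof (rule wfI_min)
      fix E and G :: "'a set set"
      assume "E \<in> G"
      then obtain x where x: "x \<in> \<xi> ` G" and x_min: "\<And>y. (y, x) \<in> ?W - Id \<Longrightarrow> y \<notin> \<xi> ` G"
        by (rule wfE_min[OF wfW imageI[of E G \<xi>]]) blast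
      show "\<exists>z\<in>G. \<forall>y. (y, z) \<in> Q \<longrightarrow> y \<notin> G"
      proof (cases "x \<in> A")
        case True
        then have "wf (R x)"
          using R by (simp add: noncovering_order_def)
        then have "wf (inv_image (R x) t)"
          by (rule wf_inv_image)
        moreover have "{E \<in> G. \<xi> E = x} \<noteq> {}"
          using x by blast
        ultimately obtain z where "z \<in> {E \<in> G. \<xi> E = x}"
          and "\<And>y. (y, z) \<in> inv_image (R x) t \<Longrightarrow> y \<notin> {E \<in> G. \<xi> E = x}"
          by (rule wfE_min') blast
        then show ?thesis
          using x_min by (intro bexI[of _ z]) (auto simp: Q_def)
      next
        case False
        then show ?thesis
          using x by (auto simp: Q_def)
      qed
    qed
    moreover have "total_on \<H> Q"
    proof (rule total_onI)
      fix E F assume EF: "E \<in> \<H>" "F \<in> \<H>" "E \<noteq> F"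
      have "\<xi> E = \<xi> F \<or> (\<xi> E, \<xi> F) \<in> ?W - Id \<or> (\<xi> F, \<xi> E) \<in> ?W - Id"
        using card_of_well_order_on[of A] \<xi>(1)[OF EF(1)] \<xi>(1)[OF EF(2)]
        by (auto simp: order_on_defs total_on_def)
      moreover have "(t E, t F) \<in> R (\<xi> E) \<or> (t F, t E) \<in> R (\<xi> E)" if "\<xi> E = \<xi> F"
      proof -
        have "total_on (t ` {F \<in> \<H>. \<xi> F = \<xi> E}) (R (\<xi> E))"
          using R[OF \<xi>(1)[OF EF(1)]] by (simp add: noncovering_order_def)
        then show ?thesis
          using EF t_inj[OF EF] that by (simp add: total_on_def)
      qed
      ultimately show "(E, F) \<in> Q \<or> (F, E) \<in> Q"
        using \<xi>(1)[OF EF(1)] \<xi>(1)[OF EF(2)] unfolding Q_def mem_Collect_eq case_prod_conv by metis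
    qed
    moreover have "\<not> E \<subseteq> \<Union>{F \<in> \<H>. (F, E) \<in> Q}" if E: "E \<in> \<H>" for E
    proof -
      \<comment> \<open>A point v of \<open>t E\<close> avoids all edges of earlier index, as these
        lie in \<open>P (\<xi> E)\<close>. For F of the same index the removed set is the same, so v
        in F would mean v in \<open>t F\<close>; hence avoiding the earlier trimmed edges is
        enough.\<close>
      have "\<not> t E \<subseteq> \<Union>{X \<in> t ` {F \<in> \<H>. \<xi> F = \<xi> E}. (X, t E) \<in> R (\<xi> E)}"
        using R[OF \<xi>(1)[OF E]] E by (simp add: noncovering_order_def)
      then obtain v where v: "v \<in> t E"
        and fresh: "\<And>F. F \<in> \<H> \<Longrightarrow> \<xi> F = \<xi> E \<Longrightarrow> (t F, t E) \<in> R (\<xi> E) \<Longrightarrow> v \<notin> t F"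
        by blast
      have "v \<notin> F" if F: "F \<in> \<H>" and FE: "(F, E) \<in> Q" for F
      proof
        assume "v \<in> F"
        from FE consider "\<xi> F \<in> underS ?W (\<xi> E)" | "\<xi> F = \<xi> E" "(t F, t E) \<in> R (\<xi> E)"
          by (auto simp: Q_def underS_def)
        then show False
        proof cases
          case 1
          then have "v \<in> P (\<xi> E)"
            using \<open>v \<in> F\<close> \<xi>(2)[OF F] by (auto simp: P_def)
          then show False
            using v by (simp add: t_def)
        next
          case 2
          then show False
            using fresh[OF F] v \<open>v \<in> F\<close> by (auto simp: t_def)
        qed
      qed
      then show ?thesis
        using v t_sub by blast
    qed
    ultimately show ?thesis
      unfolding noncovering_order_def by blast
  qed
qed

section \<open>Property C(2, \<omega>) as pairwise finite intersection\<close>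

theorem theorem2p1:
  fixes \<Lambda> :: "'a rel" and \<kappa> :: "'b rel" and \<E> :: "'a set set"
  assumes "GCH TYPE('a)"
    and "Card_order \<Lambda>" and "Card_order \<kappa>"
    and "\<kappa> \<le>o \<Lambda>"
    and "cardSuc (cardSuc natLeq) \<le>o \<kappa>"
    and "hypergraph \<E>"
    and "\<E> \<subseteq> subsets_of_card \<Lambda> \<kappa>"
    and "property_C ctwo natLeq \<E>"
  shows "\<exists>r. maximizing_well_order \<E> r"
proof -
  have "pairwise (\<lambda>E F. finite (E \<inter> F)) \<E>"
    unfolding pairwise_def
  proof (intro ballI impI)
    fix E F assume EF: "E \<in> \<E>" "F \<in> \<E>" "E \<noteq> F"
    have "bij_betw (\<lambda>X. X = E) {E, F} (UNIV :: bool set)"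
      using \<open>E \<noteq> F\<close> by (auto simp: bij_betw_def inj_on_def UNIV_bool)
    then have "|{E, F}| =o ctwo"
      unfolding ctwo_def by (rule card_of_ordIsoI)
    then have "|\<Inter>{E, F}| <o natLeq"
      using assms(8)[unfolded property_C_def, rule_format, of "{E, F}"] EF by simp
    then show "finite (E \<inter> F)"
      by (simp add: finite_iff_ordLess_natLeq)
  qed
  moreover have "|E| =o \<kappa>" if "E \<in> \<E>" for E
    using assms(7) that by (auto simp: subsets_of_card_def)
  \<comment> \<open>Any set containing all vertices can start the induction; the whole type is
    taken.\<close>
  ultimately have "\<exists>R. noncovering_order \<E> R"
    by (intro noncovering_order_exists[OF assms(1,3,5), of _ UNIV]) auto
  then show ?thesis
    using noncovering_order_imp_maximizing by blast
qed

end
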